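(* The total square loss (TSL) mean for a set of $m$ Hermitian positive-definite matrices $\{\bm{X}_1,\bm{X}_2,\dots,\bm{X}_m\}$ is given by $$\overline{\bm{X}}_{TSL}=\sum_{j=1}^m\sqrt{1+\|\bm{X}_j\|^2}\times\sum_{i=1}^m\frac{\bm{X}_i}{\sqrt{1+\|\bm{X}_i\|^2}}.$$
   Context: The matrices are $N\times N$ complex Hermitian positive-definite; $\mathscr{P}(N,\mathbb{C})$ denotes the set of all such matrices, and $\|\bm{X}\|=\sqrt{\operatorname{tr}(\bm{X}^{\mathrm H}\bm{X})}$ is the Frobenius norm, with $\bm{X}^{\mathrm H}$ the conjugate transpose. The TSL divergence is $$\delta(\bm{X},\bm{Y})=\frac12\frac{\|\bm{X}-\bm{Y}\|^2}{\sqrt{1+\|\bm{Y}\|^2}},$$ i.e. the total Bregman divergence generated by $F(\bm{X})=\frac12\|\bm{X}\|^2$. The TSL mean is defined as $$\overline{\bm{X}}:=\underset{\bm{X}\in\mathscr{P}(N,\mathbb{C})}{\operatorname{argmin}}\ \frac1m\sum_{i=1}^m\delta(\bm{X},\bm{X}_i).$$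
   Formalization: The printed factor Σ_j √(1+‖X_j‖²) is replaced by the inverse of Σ_j 1/√(1+‖X_j‖²); as printed the formula fails for every m ≥ 2 (for X_1 = X_2 = A it gives 4A, but the mean is A). *)

theory Defs
  imports "HOL-Analysis.Analysis"
begin

definition conj_transpose :: "complex ^ 'n ^ 'm \<Rightarrow> complex ^ 'm ^ 'n" where
  "conj_transpose X = (\<chi> i j. cnj (X $ j $ i))"

definition hermitian_mat :: "complex ^ 'n ^ 'n \<Rightarrow> bool" where
  "hermitian_mat X \<longleftrightarrow> conj_transpose X = X"

text \<open>The form \<open>v\<^sup>H X v\<close> is real when \<open>X\<close> is Hermitian, so comparing
  its real part with 0 is no restriction.\<close>

definition HPD :: "(complex ^ 'n ^ 'n) set" where
  "HPD = {X. hermitian_mat X \<and>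
     (\<forall>v. v \<noteq> 0 \<longrightarrow> Re (\<Sum>i\<in>UNIV. cnj (v $ i) * (X *v v) $ i) > 0)}"

text \<open>The trace of \<open>X\<^sup>H X\<close> is a nonnegative real number.\<close>

definition frob_norm :: "complex ^ 'n ^ 'n \<Rightarrow> real" where
  "frob_norm X = sqrt (Re (trace (conj_transpose X ** X)))"

definition tsl_div :: "complex ^ 'n ^ 'n \<Rightarrow> complex ^ 'n ^ 'n \<Rightarrow> real" where
  "tsl_div X Y = 1 / 2 * ((frob_norm (X - Y))\<^sup>2 / sqrt (1 + (frob_norm Y)\<^sup>2))"

definition is_tsl_mean :: "nat \<Rightarrow> (nat \<Rightarrow> complex ^ 'n ^ 'n) \<Rightarrow> complex ^ 'n ^ 'n \<Rightarrow> bool" where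
  "is_tsl_mean m X M \<longleftrightarrow>
     is_arg_min (\<lambda>A. 1 / real m * (\<Sum>i=1..m. tsl_div A (X i))) (\<lambda>A. A \<in> HPD) M"

end

theory Submission
  imports Defs
begin

text \<open>The Frobenius norm is the Euclidean norm of the space of matrices, so with
  \<open>w\<^sub>i = 1 / sqrt (1 + \<parallel>X\<^sub>i\<parallel>\<^sup>2)\<close> the objective is, up to the factor \<open>1 / (2 m)\<close>, the weighted
  sum of squares \<open>\<Sum> w\<^sub>i \<parallel>A - X\<^sub>i\<parallel>\<^sup>2\<close>. By the parallel axis theorem this is
  \<open>(\<Sum> w\<^sub>i) \<parallel>A - C\<parallel>\<^sup>2\<close> plus a constant, where \<open>C\<close> is the weighted barycentre, and \<open>C\<close> is positive
  definite because the positive definite matrices form a convex set.\<close>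

lemma frob_norm_eq_norm: "frob_norm X = norm X"
proof -
  have "Re (trace (conj_transpose X ** X)) = (\<Sum>i\<in>UNIV. \<Sum>k\<in>UNIV. (cmod (X $ k $ i))\<^sup>2)"
    by (simp add: trace_def matrix_matrix_mult_def conj_transpose_def cmod_power2
        flip: power2_eq_square)
  \<comment> \<open>The trace sums the squared entries column by column, the norm of nested vectors
    row by row.\<close>
  also have "\<dots> = (\<Sum>k\<in>UNIV. \<Sum>i\<in>UNIV. (cmod (X $ k $ i))\<^sup>2)"
    by (rule sum.swap)
  also have "\<dots> = (norm X)\<^sup>2"
    by (simp add: norm_vec_def L2_set_def sum_nonneg)
  finally show ?thesis
    by (simp add: frob_norm_def)
qed

text \<open>The quadratic form is real-linear in the matrix, so at each nonzero \<open>v\<close> its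
  value is a convex combination of two positive numbers.\<close>

lemma convex_HPD: "convex (HPD :: (complex ^ 'n ^ 'n) set)"
proof (rule convexI)
  fix A B :: "complex ^ 'n ^ 'n" and s t :: real
  assume A: "A \<in> HPD" and B: "B \<in> HPD" and st: "0 \<le> s" "0 \<le> t" "s + t = 1"
  let ?q = "\<lambda>Y v. Re (\<Sum>i\<in>UNIV. cnj (v $ i) * (Y *v v) $ i)"
  have herm: "hermitian_mat (s *\<^sub>R A + t *\<^sub>R B)"
    using A B by (simp add: HPD_def hermitian_mat_def conj_transpose_def vec_eq_iff)
  have "?q (s *\<^sub>R A + t *\<^sub>R B) v > 0" if "v \<noteq> 0" for v
  proof -
    have mv: "((s *\<^sub>R A + t *\<^sub>R B) *v v) $ i = s *\<^sub>R (A *v v) $ i + t *\<^sub>R (B *v v) $ i" for i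
      by (simp add: matrix_vector_mult_def sum.distrib scaleR_sum_right distrib_right)
    have "?q (s *\<^sub>R A + t *\<^sub>R B) v = s * ?q A v + t * ?q B v"
      unfolding mv by (simp add: sum.distrib sum_distrib_left algebra_simps)
    moreover have "?q A v > 0" "?q B v > 0"
      using A B that by (auto simp: HPD_def)
    ultimately show ?thesis
      \<comment> \<open>\<open>convex_bound_lt\<close> gives an upper bound, hence the negated
        values.\<close>
      using convex_bound_lt[of "- ?q A v" 0 "- ?q B v" s t] st by simp
  qed
  then show "s *\<^sub>R A + t *\<^sub>R B \<in> HPD"
    using herm by (simp add: HPD_def)
qed

text \<open>Expand each square after splitting \<open>a - x i\<close> as
  \<open>(a - c) + (c - x i)\<close>. The cross terms cancel because the weighted deviations from
  the barycentre sum to zero.\<close>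

lemma weighted_parallel_axis:
  fixes x :: "'i \<Rightarrow> 'a :: real_inner" and w :: "'i \<Rightarrow> real"
  assumes "sum w I \<noteq> 0"
  defines "c \<equiv> inverse (sum w I) *\<^sub>R (\<Sum>i\<in>I. w i *\<^sub>R x i)"
  shows "(\<Sum>i\<in>I. w i * (norm (a - x i))\<^sup>2) =
    sum w I * (norm (a - c))\<^sup>2 + (\<Sum>i\<in>I. w i * (norm (c - x i))\<^sup>2)"
proof -
  have "(\<Sum>i\<in>I. w i *\<^sub>R (c - x i)) = sum w I *\<^sub>R c - (\<Sum>i\<in>I. w i *\<^sub>R x i)"
    by (simp add: scaleR_diff_right sum_subtractf scaleR_left.sum)
  also have "\<dots> = 0"
    using assms(1) by (simp add: c_def)
  finally have zero: "(\<Sum>i\<in>I. w i * ((a - c) \<bullet> (c - x i))) = 0"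
    by (metis (no_types, lifting) inner_scaleR_right inner_sum_right inner_zero_right sum.cong)
  have "w i * (norm (a - x i))\<^sup>2 =
      w i * (norm (a - c))\<^sup>2 + 2 * (w i * ((a - c) \<bullet> (c - x i))) + w i * (norm (c - x i))\<^sup>2" for i
    by (simp add: power2_norm_eq_inner inner_diff_left inner_diff_right inner_commute algebra_simps)
  then show ?thesis
    by (simp add: sum.distrib zero flip: sum_distrib_left sum_distrib_right)
qed

lemma is_arg_min_unique:
  fixes f :: "'a \<Rightarrow> 'b :: linorder"
  assumes "P c" "\<And>a. P a \<Longrightarrow> a \<noteq> c \<Longrightarrow> f c < f a"
  shows "is_arg_min f P M \<longleftrightarrow> M = c"
  using assms by (metis is_arg_min_linorder less_le_not_le order_refl)

text \<open>The leading factor must be the reciprocal of the sum of the weights. The sum of the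
  reciprocal weights would not do: for two copies of a matrix \<open>Y\<close> it would yield
  \<open>4 Y\<close> instead of \<open>Y\<close>.\<close>

theorem proposition7:
  fixes X :: "nat \<Rightarrow> complex ^ 'n ^ 'n" and m :: nat and M :: "complex ^ 'n ^ 'n"
  assumes "m \<ge> 1"
    and "\<And>i. i \<in> {1..m} \<Longrightarrow> X i \<in> HPD"
  shows "is_tsl_mean m X M \<longleftrightarrow>
    M = inverse (\<Sum>j=1..m. 1 / sqrt (1 + (frob_norm (X j))\<^sup>2)) *\<^sub>R
        (\<Sum>i=1..m. (1 / sqrt (1 + (frob_norm (X i))\<^sup>2)) *\<^sub>R X i)"
proof -
  define w where "w i = 1 / sqrt (1 + (frob_norm (X i))\<^sup>2)" for i
  define W where "W = sum w {1..m}"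
  define C where "C = inverse W *\<^sub>R (\<Sum>i=1..m. w i *\<^sub>R X i)"
  define f where "f A = 1 / real m * (\<Sum>i=1..m. tsl_div A (X i))" for A
  have w_pos: "w i > 0" for i
    by (simp add: w_def add_pos_nonneg)
  have W_pos: "W > 0"
    unfolding W_def using assms(1) w_pos by (intro sum_pos) auto
  \<comment> \<open>Dividing each weight by \<open>W\<close> makes the coefficients sum to 1, so
    \<open>C\<close> is a genuine convex combination.\<close>
  have "(\<Sum>i=1..m. (w i / W) *\<^sub>R X i) \<in> HPD"
    using convex_HPD assms(2) w_pos W_pos
    by (intro convex_sum) (auto simp: W_def less_imp_le simp flip: sum_divide_distrib)
  then have C_HPD: "C \<in> HPD"
    by (simp add: C_def scaleR_sum_right divide_inverse mult.commute)
  have f_eq: "f A = 1 / (2 * real m) * (\<Sum>i=1..m. w i * (norm (A - X i))\<^sup>2)" for A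
    by (simp add: f_def tsl_div_def w_def frob_norm_eq_norm sum_divide_distrib mult_ac)
  \<comment> \<open>The residual term of the parallel axis identity is, after scaling, the objective
    at \<open>C\<close> itself.\<close>
  have "f A = 1 / (2 * real m) * (W * (norm (A - C))\<^sup>2) + f C" for A
    using weighted_parallel_axis[of w "{1..m}" A X] W_pos
    unfolding f_eq C_def W_def by (simp add: add_divide_distrib)
  moreover have "1 / (2 * real m) * (W * (norm (A - C))\<^sup>2) > 0" if "A \<noteq> C" for A
    using that W_pos assms(1) by simp
  ultimately have "f C < f A" if "A \<noteq> C" for A
    using that by (metis less_add_same_cancel2)
  then have "is_arg_min f (\<lambda>A. A \<in> HPD) M \<longleftrightarrow> M = C"
    using C_HPD by (intro is_arg_min_unique) auto
  then show ?thesis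
    unfolding is_tsl_mean_def f_def[abs_def] C_def W_def w_def[abs_def] .
qed

end
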